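(* Let $q$ be a prime power, let $m,n\ge 1$, and let $\mathcal{C}$ be a nondegenerate $[n,k,d]_{q^m/q}$ code with generator matrix $G\in\mathbb{F}_{q^m}^{k\times n}$. The following statements are equivalent: (1) The code $\mathcal{C}$ is rank-metric intersecting. (2) For all $A\in\mathrm{GL}(n,q)$, the code $\mathcal{C}\cdot A=\{cA : c\in\mathcal{C}\}$ is Hamming-metric intersecting. (3) For all $A\in\mathrm{GL}(n,q)$, the multiset $\mathcal{S}$ of points of $\mathrm{PG}(k-1,q^m)$ obtained by identifying the columns of $G\cdot A$ with points of the projective space is not contained in the union of two hyperplanes. (4) The $[n,k]_{q^m/q}$ system $\mathcal{U}$ corresponding to $\mathcal{C}$, i.e. the $\mathbb{F}_q$-span in $\mathbb{F}_{q^m}^k$ of the columns of $G$, is not $2$-spannable.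
   Context: Support and rank: fix an $\mathbb{F}_q$-basis $\Gamma$ of $\mathbb{F}_{q^m}$. For $x=(x_1,\dots,x_n)\in\mathbb{F}_{q^m}^n$ let $\mathrm{Mat}_\Gamma(x)\in\mathbb{F}_q^{m\times n}$ be the matrix whose $j$-th column is the coordinate vector of $x_j$ in the basis $\Gamma$. The support $\sigma(x)\subseteq\mathbb{F}_q^n$ is the $\mathbb{F}_q$-row space of $\mathrm{Mat}_\Gamma(x)$, and $\mathrm{rk}(x)=\dim_{\mathbb{F}_q}\sigma(x)$; both are independent of $\Gamma$. An $[n,k,d]_{q^m/q}$ code is an $\mathbb{F}_{q^m}$-linear subspace $\mathcal{C}$ of $\mathbb{F}_{q^m}^n$ with $k=\dim_{\mathbb{F}_{q^m}}\mathcal{C}\ge 1$ and minimum distance $d=\min_{c\in\mathcal{C}\setminus\{0\}}\mathrm{rk}(c)$. A generator matrix is a $k\times n$ matrix over $\mathbb{F}_{q^m}$ whose row space is $\mathcal{C}$. The code is nondegenerate if $\sum_{c\in\mathcal{C}}\sigma(c)=\mathbb{F}_q^n$ (equivalently, the columns of a generator matrix are $\mathbb{F}_q$-linearly independent). The code is rank-metric intersecting if $\sigma(c)\cap\sigma(c')\ne\{0\}$ for all $c,c'\in\mathcal{C}\setminus\{0\}$. A linear code is Hamming-metric intersecting if for any two nonzero codewords $c,c'$ there is a coordinate $i$ with $c_i\ne 0$ and $c'_i\neq 0$. An $[n,k]_{q^m/q}$ system is an $\mathbb{F}_q$-subspace $\mathcal{U}\subseteq\mathbb{F}_{q^m}^k$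 of $\mathbb{F}_q$-dimension $n$ with $\langle\mathcal{U}\rangle_{\mathbb{F}_{q^m}}=\mathbb{F}_{q^m}^k$. It is $2$-spannable if there exist two $\mathbb{F}_{q^m}$-linear hyperplanes $\mathcal{H}_1,\mathcal{H}_2$ of $\mathbb{F}_{q^m}^k$ such that $\mathcal{U}=(\mathcal{H}_1\cap\mathcal{U})+(\mathcal{H}_2\cap\mathcal{U})$. *)

theory Defs
  imports "HOL-Analysis.Cartesian_Space" "HOL-Library.Multiset"
begin

text \<open>
  The base field is a finite field type \<open>'q\<close>, the extension field is a finite field type \<open>'e\<close>,
  and the extension is given by a field embedding \<open>emb :: 'q \<Rightarrow> 'e\<close>; so the prime power
  is \<open>CARD('q)\<close>. Its degree is \<open>CARD('m)\<close>, where \<open>'m\<close> indexes a basis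
  \<open>\<Gamma>\<close> of the extension. The length and the dimension of a code are
  \<open>CARD('n)\<close> and \<open>CARD('d)\<close>, for finite index types \<open>'n\<close> and \<open>'d\<close>.
  Index types are nonempty, so these numbers are at least 1.
\<close>

definition field_embedding :: "('q::field \<Rightarrow> 'e::field) \<Rightarrow> bool" where
  "field_embedding emb \<longleftrightarrow>
     emb 1 = 1 \<and> (\<forall>a b. emb (a + b) = emb a + emb b) \<and> (\<forall>a b. emb (a * b) = emb a * emb b)"

abbreviation scale_ext :: "('q::field \<Rightarrow> 'e::field) \<Rightarrow> 'q \<Rightarrow> 'e \<Rightarrow> 'e" where
  "scale_ext emb \<equiv> \<lambda>a x. emb a * x"

abbreviation scale_vec :: "('q::field \<Rightarrow> 'e::field) \<Rightarrow> 'q \<Rightarrow> 'e^'d \<Rightarrow> 'e^'d" where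
  "scale_vec emb \<equiv> \<lambda>a v. emb a *s v"

definition ext_basis :: "('q::field \<Rightarrow> 'e::field) \<Rightarrow> ('m \<Rightarrow> 'e) \<Rightarrow> bool" where
  "ext_basis emb \<Gamma> \<longleftrightarrow>
     inj \<Gamma> \<and> \<not> module.dependent (scale_ext emb) (range \<Gamma>) \<and>
     module.span (scale_ext emb) (range \<Gamma>) = UNIV"

definition coord_matrix :: "('q::field \<Rightarrow> 'e::field) \<Rightarrow> ('m::finite \<Rightarrow> 'e) \<Rightarrow> 'e^'n \<Rightarrow> 'q^'n^'m" where
  "coord_matrix emb \<Gamma> x =
     (\<chi> i j. module.representation (scale_ext emb) (range \<Gamma>) (x $ j) (\<Gamma> i))"

definition support :: "('q::field \<Rightarrow> 'e::field) \<Rightarrow> ('m::finite \<Rightarrow> 'e) \<Rightarrow> 'e^'n \<Rightarrow> ('q^'n) set" where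
  "support emb \<Gamma> x = vec.span (rows (coord_matrix emb \<Gamma> x))"

definition rk :: "('q::field \<Rightarrow> 'e::field) \<Rightarrow> ('m::finite \<Rightarrow> 'e) \<Rightarrow> 'e^'n \<Rightarrow> nat" where
  "rk emb \<Gamma> x = vec.dim (support emb \<Gamma> x)"

text \<open>An $[n,k,d]$ code, with \<open>n = CARD('n)\<close>.\<close>

definition rank_code ::
  "('q::{field,finite} \<Rightarrow> 'e::{field,finite}) \<Rightarrow> ('m::finite \<Rightarrow> 'e) \<Rightarrow> nat \<Rightarrow> nat \<Rightarrow> ('e^'n) set \<Rightarrow> bool" where
  "rank_code emb \<Gamma> k d C \<longleftrightarrow>
     vec.subspace C \<and> vec.dim C = k \<and> k \<ge> 1 \<and> d = Min (rk emb \<Gamma> ` (C - {0}))"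

text \<open>The number of rows of \<open>G\<close> must also be the dimension of the code.\<close>

definition generator_matrix :: "'e::field^'n^'d \<Rightarrow> ('e^'n) set \<Rightarrow> bool" where
  "generator_matrix G C \<longleftrightarrow> vec.dim C = CARD('d) \<and> vec.span (rows G) = C"

text \<open>The sum of a family of subspaces is the span of its union.\<close>

definition nondegenerate ::
  "('q::field \<Rightarrow> 'e::field) \<Rightarrow> ('m::finite \<Rightarrow> 'e) \<Rightarrow> ('e^'n) set \<Rightarrow> bool" where
  "nondegenerate emb \<Gamma> C \<longleftrightarrow> vec.span (\<Union>c\<in>C. support emb \<Gamma> c) = UNIV"

definition rank_intersecting ::
  "('q::field \<Rightarrow> 'e::field) \<Rightarrow> ('m::finite \<Rightarrow> 'e) \<Rightarrow> ('e^'n) set \<Rightarrow> bool" where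
  "rank_intersecting emb \<Gamma> C \<longleftrightarrow>
     (\<forall>c\<in>C - {0}. \<forall>c'\<in>C - {0}. support emb \<Gamma> c \<inter> support emb \<Gamma> c' \<noteq> {0})"

definition hamming_intersecting :: "('e::zero^'n) set \<Rightarrow> bool" where
  "hamming_intersecting C \<longleftrightarrow>
     (\<forall>c\<in>C - {0}. \<forall>c'\<in>C - {0}. \<exists>i. c $ i \<noteq> 0 \<and> c' $ i \<noteq> 0)"

definition code_times :: "('q::field \<Rightarrow> 'e::field) \<Rightarrow> ('e^'n) set \<Rightarrow> 'q^'n^'n \<Rightarrow> ('e^'n) set" where
  "code_times emb C A = (\<lambda>c. c v* map_matrix emb A) ` C"

definition hyperplane :: "('e::field^'d) set \<Rightarrow> bool" where
  "hyperplane H \<longleftrightarrow> vec.subspace H \<and> vec.dim H + 1 = CARD('d)"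

text \<open>Points of the projective space of \<open>'e^'d\<close> are its one-dimensional subspaces; a projective
  hyperplane is the set of the points that lie in a linear hyperplane.\<close>

definition pg_points :: "('e::field^'d) set set" where
  "pg_points = {vec.span {v} | v. v \<noteq> 0}"

definition pg_hyperplanes :: "('e::field^'d) set set set" where
  "pg_hyperplanes = {{P \<in> pg_points. P \<subseteq> H} | H. hyperplane H}"

text \<open>Every column is nonzero when \<open>M\<close> is \<open>G\<close> times an invertible matrix over the base
  field, with \<open>G\<close> a generator matrix of a nondegenerate code; then the members of this multiset
  are points.\<close>

definition column_points :: "'e::field^'n^'d \<Rightarrow> ('e^'d) set multiset" where
  "column_points M = image_mset (\<lambda>j. vec.span {column j M}) (mset_set UNIV)"

definition in_two_hyperplanes :: "('e::field^'d) set multiset \<Rightarrow> bool" where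
  "in_two_hyperplanes S \<longleftrightarrow>
     (\<exists>Y1\<in>pg_hyperplanes. \<exists>Y2\<in>pg_hyperplanes. set_mset S \<subseteq> Y1 \<union> Y2)"

definition q_system :: "('q::field \<Rightarrow> 'e::field) \<Rightarrow> nat \<Rightarrow> ('e^'d) set \<Rightarrow> bool" where
  "q_system emb n U \<longleftrightarrow>
     module.subspace (scale_vec emb) U \<and> vector_space.dim (scale_vec emb) U = n \<and>
     vec.span U = UNIV"

definition code_system :: "('q::field \<Rightarrow> 'e::field) \<Rightarrow> 'e^'n^'d \<Rightarrow> ('e^'d) set" where
  "code_system emb G = module.span (scale_vec emb) (columns G)"

definition two_spannable :: "('e::field^'d) set \<Rightarrow> bool" where
  "two_spannable U \<longleftrightarrow>
     (\<exists>H1 H2. hyperplane H1 \<and> hyperplane H2 \<and> U = {x + y | x y. x \<in> H1 \<inter> U \<and> y \<in> H2 \<inter> U})"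

lemma field_embedding_vector_space:
  assumes "field_embedding emb"
  shows "vector_space (scale_ext emb)" "vector_space (scale_vec emb)"
  using assms unfolding field_embedding_def
  by (unfold_locales; vector algebra_simps)+

lemma field_embedding_0: "field_embedding emb \<Longrightarrow> emb 0 = 0"
  unfolding field_embedding_def by (metis add_cancel_left_left)

lemma field_embedding_sum: "field_embedding emb \<Longrightarrow> emb (sum f A) = (\<Sum>a\<in>A. emb (f a))"
  using field_embedding_0[of emb]
  by (induction A rule: infinite_finite_induct) (auto simp: field_embedding_def)

lemma coord_matrix_sum:
  assumes emb: "field_embedding emb" and "ext_basis emb \<Gamma>"
  shows "(\<Sum>i\<in>UNIV. emb (coord_matrix emb \<Gamma> x $ i $ j) * \<Gamma> i) = x $ j"
proof -
  interpret vector_space "scale_ext emb" using field_embedding_vector_space(1)[OF emb] .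
  have b: "inj \<Gamma>" "independent (range \<Gamma>)" "x $ j \<in> span (range \<Gamma>)"
    using assms(2) by (auto simp: ext_basis_def)
  have "(\<Sum>b\<in>range \<Gamma>. emb (representation (range \<Gamma>) (x $ j) b) * b) = x $ j"
    by (rule sum_representation_eq) (use b in auto)
  then show ?thesis using b(1) by (simp add: coord_matrix_def sum.reindex)
qed

lemma coord_matrix_unique:
  fixes \<Gamma> :: "'m::finite \<Rightarrow> 'e::field"
  assumes emb: "field_embedding emb" and "ext_basis emb \<Gamma>"
    and 0: "(\<Sum>i\<in>UNIV. emb (r i) * \<Gamma> i) = 0"
  shows "r i = 0"
proof -
  interpret vector_space "scale_ext emb" using field_embedding_vector_space(1)[OF emb] .
  have b: "inj \<Gamma>" "independent (range \<Gamma>)" using assms(2) by (auto simp: ext_basis_def)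
  have "(\<Sum>b\<in>range \<Gamma>. emb (r (inv \<Gamma> b)) * b) = 0" using 0 b(1) by (simp add: sum.reindex)
  then have "r (inv \<Gamma> (\<Gamma> i)) = 0"
    using b(2) by (intro independentD[of "range \<Gamma>" "range \<Gamma>" "\<lambda>b. r (inv \<Gamma> b)"]) auto
  then show ?thesis using b(1) by simp
qed

lemma nondegenerate_columns:
  fixes G :: "'e::{field,finite}^'n^'d" and emb :: "'q::{field,finite} \<Rightarrow> 'e"
  assumes emb: "field_embedding emb" and \<Gamma>: "ext_basis emb \<Gamma>"
    and nd: "nondegenerate emb \<Gamma> C" and G: "generator_matrix G C"
    and 0: "(\<Sum>j\<in>UNIV. emb (a $ j) *s column j G) = 0"
  shows "a = (0 :: 'q^'n)"
proof -
  have row: "(\<Sum>j\<in>UNIV. emb (a $ j) * c $ j) = 0" if "c \<in> vec.span (rows G)" for c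
    using that
  proof (induction rule: vec.span_induct_alt)
    case base then show ?case by simp
  next
    case (step s v w)
    from step(1) obtain i where v: "v = row i G" by (auto simp: rows_def)
    have "(\<Sum>j\<in>UNIV. emb (a $ j) * v $ j) = 0"
      using arg_cong[OF 0, of "\<lambda>x. x $ i"] by (simp add: v row_def column_def)
    moreover have "(\<Sum>j\<in>UNIV. emb (a $ j) * (s *s v + w) $ j)
      = s * (\<Sum>j\<in>UNIV. emb (a $ j) * v $ j) + (\<Sum>j\<in>UNIV. emb (a $ j) * w $ j)"
      by (simp add: algebra_simps sum.distrib sum_distrib_left)
    ultimately show ?case using step by simp
  qed
  have coords: "(\<Sum>j\<in>UNIV. a $ j * coord_matrix emb \<Gamma> c $ i $ j) = 0" if "c \<in> C" for c i
  proof -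
    have "(\<Sum>i\<in>UNIV. emb (\<Sum>j\<in>UNIV. a $ j * coord_matrix emb \<Gamma> c $ i $ j) * \<Gamma> i)
      = (\<Sum>i\<in>UNIV. \<Sum>j\<in>UNIV. emb (a $ j) * (emb (coord_matrix emb \<Gamma> c $ i $ j) * \<Gamma> i))"
      using emb by (simp add: field_embedding_sum field_embedding_def sum_distrib_right sum_distrib_left mult_ac)
    also have "\<dots> = (\<Sum>j\<in>UNIV. emb (a $ j) * (\<Sum>i\<in>UNIV. emb (coord_matrix emb \<Gamma> c $ i $ j) * \<Gamma> i))"
      by (subst sum.swap) (simp add: sum_distrib_left)
    also have "\<dots> = 0" using row[of c] that G by (simp add: coord_matrix_sum[OF emb \<Gamma>] generator_matrix_def)
    finally show ?thesis
      by (rule coord_matrix_unique[OF emb \<Gamma>])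
  qed
  define N where "N = {v :: 'q^'n. (\<Sum>j\<in>UNIV. a $ j * v $ j) = 0}"
  have N: "vec.subspace N"
    unfolding vec.subspace_def N_def
    by (auto simp: algebra_simps sum.distrib sum_distrib_left[symmetric])
  have "support emb \<Gamma> c \<subseteq> N" if "c \<in> C" for c
    unfolding support_def using coords[OF that]
    by (intro vec.span_minimal N) (auto simp: rows_def row_def N_def)
  then have "N = UNIV"
    using vec.span_minimal[OF _ N, of "\<Union>c\<in>C. support emb \<Gamma> c"] nd
    by (auto simp: nondegenerate_def)
  then have "axis j 1 \<in> N" for j by simp
  then have "a $ j = 0" for j by (simp add: N_def axis_def if_distrib cong: if_cong)
  then show ?thesis by (simp add: vec_eq_iff)
qed

lemma generator_matrix_span_columns:
  fixes G :: "'e::{field,finite}^'n^'d"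
  assumes "generator_matrix G C"
  shows "vec.span (columns G) = UNIV"
proof -
  have dim: "vec.dim (rows G) = CARD('d)" using assms by (auto simp: generator_matrix_def)
  have rows: "rows G = range (\<lambda>i. row i G)" by (auto simp: rows_def)
  have "CARD('d) \<le> card (rows G)" using vec.dim_le_card'[of "rows G"] dim by (simp add: rows)
  then have card: "card (rows G) = CARD('d)"
    using card_image_le[of UNIV "\<lambda>i. row i G"] by (simp add: rows)
  then have inj: "inj (\<lambda>i. row i G)" by (simp add: rows eq_card_imp_inj_on)
  have ind: "vec.independent (rows G)"
    by (rule vec.card_le_dim_spanning[of _ "vec.span (rows G)"])
       (use dim card in \<open>auto simp: vec.span_superset rows\<close>)
  have inv_row: "inv (\<lambda>i. row i G) (row i G) = i" for i
    using inv_f_f[OF inj, of i] by simp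
  have "\<forall>i. c i = 0" if "(\<Sum>i\<in>UNIV. c i *s row i G) = 0" for c
  proof
    fix i
    have "(\<Sum>v\<in>rows G. c (inv (\<lambda>i. row i G) v) *s v) = 0"
      unfolding rows using that inj by (simp add: sum.reindex inv_row)
    then have "c (inv (\<lambda>i. row i G) (row i G)) = 0"
      using ind by (intro vec.independentD[of "rows G" "rows G" "\<lambda>v. c (inv (\<lambda>i. row i G) v)"]) (auto simp: rows)
    then show "c i = 0" by (simp add: inv_row)
  qed
  then show ?thesis
    unfolding matrix_right_invertible_span_columns[symmetric] matrix_right_invertible_independent_rows
    by blast
qed

lemma code_system_q_system:
  fixes G :: "'e::{field,finite}^'n^'d" and emb :: "'q::{field,finite} \<Rightarrow> 'e"
  assumes emb: "field_embedding emb" and \<Gamma>: "ext_basis emb \<Gamma>"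
    and nd: "nondegenerate emb \<Gamma> C" and G: "generator_matrix G C"
  shows "q_system emb CARD('n) (code_system emb G)"
proof -
  interpret vector_space "scale_vec emb :: 'q \<Rightarrow> 'e^'d \<Rightarrow> 'e^'d"
    using field_embedding_vector_space(2)[OF emb] .
  have cols: "columns G = range (\<lambda>j. column j G)" by (auto simp: columns_def)
  have inj: "inj (\<lambda>j. column j G)"
  proof (rule injI, rule ccontr)
    fix i j assume e: "column i G = column j G" and ne: "i \<noteq> j"
    let ?a = "axis i 1 - axis j 1 :: 'q^'n"
    have emb': "emb (-1) = -1"
      using emb field_embedding_0[OF emb] unfolding field_embedding_def
      by (metis add.inverse_unique add.right_inverse)
    have "emb (?a $ l) = (if l = i then 1 else 0) - (if l = j then 1 else 0)" for l
      using ne emb emb' field_embedding_0[OF emb] by (auto simp: axis_def field_embedding_def)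
    then have "(\<Sum>l\<in>UNIV. emb (?a $ l) *s column l G) = column i G - column j G"
      by (simp add: vec_eq_iff left_diff_distrib sum_subtractf if_distrib[of "\<lambda>x. x * _"] cong: if_cong)
    then have "?a = 0" using e by (intro nondegenerate_columns[OF emb \<Gamma> nd G]) simp
    then show False using ne by (metis axis_eq_axis eq_iff_diff_eq_0 zero_neq_one)
  qed
  have "independent (columns G)"
  proof (rule independent_if_scalars_zero)
    fix f v assume s: "(\<Sum>x\<in>columns G. emb (f x) *s x) = 0" and v: "v \<in> columns G"
    have "(\<Sum>j\<in>UNIV. emb ((\<chi> j. f (column j G)) $ j) *s column j G) = 0"
      using s inj by (simp add: cols sum.reindex)
    then have "(\<chi> j. f (column j G)) = 0" by (rule nondegenerate_columns[OF emb \<Gamma> nd G])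
    then show "f v = 0" using v by (auto simp: cols vec_eq_iff)
  qed (simp add: cols)
  then have "dim (span (columns G)) = CARD('n)"
    using inj by (simp add: dim_eq_card_independent cols card_image)
  moreover have "vec.span (span (columns G)) = UNIV"
    using vec.span_mono[OF span_superset[of "columns G"]] generator_matrix_span_columns[OF G] by auto
  ultimately show ?thesis by (simp add: q_system_def code_system_def)
qed

end

theory Submission
  imports Defs
begin

text \<open>
  For a word \<open>c\<close> let \<open>K c\<close> be the space of \<open>a \<in> F\<^sub>q\<^sup>n\<close> with \<open>\<Sum>\<^sub>j a\<^sub>j c\<^sub>j = 0\<close>. It is the
  annihilator of the support of \<open>c\<close>, so two supports intersect trivially iff
  \<open>K c + K c' = F\<^sub>q\<^sup>n\<close>, that is, iff \<open>F\<^sub>q\<^sup>n\<close> has a basis inside \<open>K c \<union> K c'\<close>. The columns of an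
  invertible matrix \<open>A\<close> form such a basis exactly when \<open>c A\<close> and \<open>c' A\<close> have no common nonzero
  coordinate. Finally \<open>a \<mapsto> G a\<close> identifies \<open>F\<^sub>q\<^sup>n\<close> with the system of the code, and for
  \<open>c = u G\<close> it maps \<open>K c\<close> onto the intersection of the system with the hyperplane \<open>u\<^sup>\<bottom>\<close>.
\<close>

section \<open>Linear algebra: annihilators, normal vectors of hyperplanes, bases as invertible
  matrices\<close>

definition dot :: "'a::field^'n \<Rightarrow> 'a^'n \<Rightarrow> 'a" where
  "dot u v = (\<Sum>i\<in>UNIV. u $ i * v $ i)"

definition annihilator :: "('a::field^'n) set \<Rightarrow> ('a^'n) set" where
  "annihilator S = {a. \<forall>v\<in>S. dot a v = 0}"

lemma dot_commute: "dot u v = dot v u"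
  by (simp add: dot_def mult.commute)

lemma dot_add_right: "dot u (v + w) = dot u v + dot u w"
  by (simp add: dot_def algebra_simps sum.distrib)

lemma dot_scale_right: "dot u (a *s v) = a * dot u v"
  by (simp add: dot_def sum_distrib_left mult_ac)

lemma dot_add_left: "dot (u + v) w = dot u w + dot v w"
  by (simp add: dot_def algebra_simps sum.distrib)

lemma dot_scale_left: "dot (a *s u) v = a * dot u v"
  by (simp add: dot_def sum_distrib_left mult_ac)

lemma dot_zero_left [simp]: "dot 0 u = 0"
  by (simp add: dot_def)

lemma dot_zero_right [simp]: "dot u 0 = 0"
  by (simp add: dot_def)

lemma dot_axis_right [simp]: "dot u (axis i 1) = u $ i"
  by (simp add: dot_def axis_def if_distrib cong: if_cong)

lemma dot_sum_right: "dot u (\<Sum>x\<in>S. f x) = (\<Sum>x\<in>S. dot u (f x))"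
  by (induction S rule: infinite_finite_induct) (auto simp: dot_add_right)

lemma subspace_dot: "vec.subspace {v. dot u v = 0}"
  by (auto simp: vec.subspace_def dot_add_right dot_scale_right)

lemma subspace_annihilator: "vec.subspace (annihilator S)"
  unfolding annihilator_def
  by (auto simp: vec.subspace_def dot_add_left dot_scale_left)

lemma annihilator_span: "annihilator (vec.span S) = annihilator S"
proof -
  have "dot a v = 0" if "\<forall>v\<in>S. dot a v = 0" "v \<in> vec.span S" for a v
    using that vec.span_minimal[OF _ subspace_dot[of a], of S] by auto
  then show ?thesis by (auto simp: annihilator_def vec.span_base)
qed

lemma annihilator_Un: "annihilator (S \<union> T) = annihilator S \<inter> annihilator T"
  by (auto simp: annihilator_def)

lemma annihilator_UNIV: "annihilator UNIV = {0}"
proof -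
  have "a = 0" if "\<forall>v. dot a v = 0" for a :: "'a^'n"
    using that[THEN spec, of "axis _ 1"] by (simp add: vec_eq_iff)
  then show ?thesis by (auto simp: annihilator_def)
qed

text \<open>A basis of \<open>S\<close> stays independent when \<open>v\<close> is added, so some
  linear map kills \<open>S\<close> and not \<open>v\<close>; a row of its matrix represents the
  functional sought.\<close>

lemma separating_functional:
  fixes S :: "('a::field^'n) set"
  assumes S: "vec.subspace S" and v: "v \<notin> S"
  obtains u where "u \<in> annihilator S" "dot u v \<noteq> 0"
proof -
  obtain B where B: "B \<subseteq> S" "vec.independent B" "S \<subseteq> vec.span B"
    using vec.basis_exists[of S] by metis
  have "vec.span B \<subseteq> S" using B(1) S by (rule vec.span_minimal)
  then have "vec.independent (insert v B)"
    using B v by (intro vec.independent_insertI) auto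
  then obtain f where f: "Vector_Spaces.linear (*s) (*s) f"
    "\<forall>x\<in>insert v B. f x = (if x = v then 1 else 0 :: 'a^'n)"
    using vec.linear_independent_extend[of "insert v B" "\<lambda>x. if x = v then 1 else 0 :: 'a^'n"] by blast
  \<comment> \<open>\<open>f v\<close> is the all-ones vector, so every row of the matrix of
    \<open>f\<close> would do; \<open>undefined\<close> merely picks one.\<close>
  define u where "u = row undefined (matrix f)"
  have u: "dot u x = f x $ undefined" for x
    using matrix_works[OF f(1), of x]
    by (simp add: u_def dot_def row_def matrix_vector_mult_def vec_eq_iff)
  have "u \<in> annihilator B"
    using f(2) v B(1) by (auto simp: annihilator_def u)
  moreover have "vec.span B = S" using \<open>vec.span B \<subseteq> S\<close> B(3) by blast
  ultimately have "u \<in> annihilator S" by (metis annihilator_span)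
  moreover have "dot u v \<noteq> 0" using f(2) by (simp add: u)
  ultimately show ?thesis by (rule that)
qed

text \<open>A vector outside \<open>S\<close> is detected by separation. No orthogonal decomposition
  is available: over a finite field \<open>S\<close> may meet its annihilator nontrivially.\<close>

lemma annihilator_annihilator:
  assumes "vec.subspace S"
  shows "annihilator (annihilator S) = S"
proof
  show "S \<subseteq> annihilator (annihilator S)"
    by (auto simp: annihilator_def dot_commute)
  show "annihilator (annihilator S) \<subseteq> S"
  proof
    fix v assume v: "v \<in> annihilator (annihilator S)"
    show "v \<in> S"
    proof (rule ccontr)
      assume "v \<notin> S"
      then obtain u where "u \<in> annihilator S" "dot u v \<noteq> 0"
        using separating_functional[OF assms] by metis
      then show False using v by (auto simp: annihilator_def dot_commute)
    qed
  qed
qed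

text \<open>Passing to annihilators turns the sum into \<open>S \<inter> T\<close> by biduality, and
  a subspace is the whole space iff its annihilator is zero.\<close>

lemma span_annihilators_eq_UNIV_iff:
  assumes "vec.subspace S" "vec.subspace T"
  shows "vec.span (annihilator S \<union> annihilator T) = UNIV \<longleftrightarrow> S \<inter> T = {0}"
proof -
  have ann: "annihilator (vec.span (annihilator S \<union> annihilator T)) = S \<inter> T"
    using assms by (simp add: annihilator_span annihilator_Un annihilator_annihilator)
  show ?thesis
  proof
    assume "vec.span (annihilator S \<union> annihilator T) = UNIV"
    with ann show "S \<inter> T = {0}" by (simp add: annihilator_UNIV)
  next
    assume "S \<inter> T = {0}"
    \<comment> \<open>Annihilating once more recovers the span on the left and gives the whole space
      on the right.\<close>
    then have "annihilator (annihilator (vec.span (annihilator S \<union> annihilator T))) = annihilator {0}"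
      by (simp add: ann)
    then show "vec.span (annihilator S \<union> annihilator T) = UNIV"
      by (simp add: annihilator_annihilator vec.subspace_span) (simp add: annihilator_def)
  qed
qed

text \<open>Separating \<open>H\<close> from an outside vector yields a normal vector, and
  dimensions force equality. Normal vectors \<open>u\<close> later turn pairs of hyperplanes into
  pairs of codewords \<open>u v* G\<close>.\<close>

lemma hyperplane_iff:
  fixes H :: "('e::field^'d) set"
  shows "hyperplane H \<longleftrightarrow> (\<exists>u. u \<noteq> 0 \<and> H = {v. dot u v = 0})"
proof -
  have proper: "vec.dim {v. dot u v = 0} < CARD('d)" if "u \<noteq> 0" for u :: "'e^'d"
  proof -
    obtain i where "u $ i \<noteq> 0" using \<open>u \<noteq> 0\<close> by (auto simp: vec_eq_iff)
    then have "axis i 1 \<notin> {v. dot u v = 0}" by simp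
    then have "{v. dot u v = 0} \<subset> UNIV" by blast
    then have "vec.span {v. dot u v = 0} \<subset> vec.span UNIV"
      using subspace_dot[of u] by (metis vec.span_UNIV vec.span_eq_iff)
    then have "vec.dim {v. dot u v = 0} < vec.dim (UNIV :: ('e^'d) set)"
      by (rule vec.dim_psubset)
    then show ?thesis by (simp add: card_cart_basis)
  qed
  show ?thesis
  proof
    assume H: "hyperplane H"
    then have "H \<noteq> UNIV" by (auto simp: hyperplane_def card_cart_basis)
    then obtain v where "v \<notin> H" by blast
    then obtain u where u: "u \<in> annihilator H" "dot u v \<noteq> 0"
      using separating_functional[of H v] H by (auto simp: hyperplane_def)
    then have "u \<noteq> 0" by auto
    \<comment> \<open>\<open>H\<close> has codimension one and the kernel of \<open>u\<close> is
      proper, so the kernel cannot be larger than \<open>H\<close>.\<close>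
    then have "vec.dim {v. dot u v = 0} \<le> vec.dim H"
      using proper[of u] H by (simp add: hyperplane_def)
    moreover have "H \<subseteq> {v. dot u v = 0}" using u(1) by (auto simp: annihilator_def)
    ultimately have "H = {v. dot u v = 0}"
      using H subspace_dot[of u] by (intro vec.subspace_dim_equal) (auto simp: hyperplane_def)
    then show "\<exists>u. u \<noteq> 0 \<and> H = {v. dot u v = 0}" using \<open>u \<noteq> 0\<close> by blast
  next
    assume "\<exists>u. u \<noteq> 0 \<and> H = {v. dot u v = 0}"
    then obtain u where u: "u \<noteq> 0" and H: "H = {v. dot u v = 0}" by blast
    obtain i where i: "u $ i \<noteq> 0" using u by (auto simp: vec_eq_iff)
    have "x \<in> vec.span (insert (axis i 1) H)" for x
    proof -
      \<comment> \<open>Subtracting the right multiple of a unit vector on which \<open>u\<close>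
        does not vanish moves \<open>x\<close> into \<open>H\<close>; hence \<open>H\<close> has
        codimension at most one.\<close>
      have "x + (- (dot u x / u $ i)) *s axis i 1 \<in> H"
        using i by (simp only: H mem_Collect_eq dot_add_right dot_scale_right dot_axis_right) simp
      then have "(x + (- (dot u x / u $ i)) *s axis i 1) + (dot u x / u $ i) *s axis i 1
          \<in> vec.span (insert (axis i 1) H)"
        by (intro vec.span_add[OF vec.span_base vec.span_scale[OF vec.span_base]]) auto
      then show ?thesis by (simp only: vec.scale_minus_left add.assoc left_minus add_0_right)
    qed
    then have "vec.span (insert (axis i 1) H) = UNIV" by blast
    then have "vec.dim (insert (axis i 1) H) = CARD('d)"
      by (metis vec.dim_span vec_dim_card)
    then have "CARD('d) \<le> vec.dim H + 1"
      by (auto simp: vec.dim_insert split: if_splits)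
    then show "hyperplane H"
      using proper[OF u] by (auto simp: hyperplane_def H subspace_dot)
  qed
qed

lemma span_Un_subspaces:
  assumes "vec.subspace S" "vec.subspace T"
  shows "vec.span (S \<union> T) = {x + y | x y. x \<in> S \<and> y \<in> T}"
  using assms by (simp add: vec.span_Un vec.span_eq_iff[THEN iffD2])

text \<open>A spanning set contains a basis, whose members become the columns of \<open>A\<close>.
  This brings the quantifier over GL(n,q) into the statements about supports and systems.\<close>

lemma span_eq_UNIV_iff_invertible:
  fixes S :: "('a::field^'n) set"
  shows "vec.span S = UNIV \<longleftrightarrow> (\<exists>A :: 'a^'n^'n. invertible A \<and> columns A \<subseteq> S)"
proof
  assume S: "vec.span S = UNIV"
  obtain B where B: "B \<subseteq> S" "vec.independent B" "S \<subseteq> vec.span B"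
    using vec.maximal_independent_subset[of S] by metis
  have span: "vec.span B = UNIV"
    using S vec.span_minimal[OF B(3) vec.subspace_span] by auto
  have "card B = CARD('n)"
    using vec.dim_eq_card_independent[OF B(2)] span by (metis vec.dim_span vec_dim_card)
  moreover have "finite B" using B(2) vec.finiteI_independent by blast
  \<comment> \<open>The basis has \<open>CARD('n)\<close> members, so the coordinate type itself can
    index it.\<close>
  ultimately obtain f where f: "bij_betw f (UNIV :: 'n set) B"
    using finite_same_card_bij[of "UNIV :: 'n set" B] by auto
  define A :: "'a^'n^'n" where "A = (\<chi> i j. f j $ i)"
  have "column j A = f j" for j by (simp add: A_def column_def vec_eq_iff)
  then have cols: "columns A = B" using f by (auto simp: columns_def bij_betw_def)
  then have "\<exists>A'. A ** A' = mat 1" using span by (simp add: matrix_right_invertible_span_columns)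
  then have "invertible A" by (simp add: invertible_right_inverse)
  then show "\<exists>A :: 'a^'n^'n. invertible A \<and> columns A \<subseteq> S" using cols B(1) by blast
next
  assume "\<exists>A :: 'a^'n^'n. invertible A \<and> columns A \<subseteq> S"
  then obtain A :: "'a^'n^'n" where A: "invertible A" "columns A \<subseteq> S" by blast
  then have "vec.span (columns A) = UNIV"
    by (simp add: matrix_right_invertible_span_columns[symmetric] invertible_right_inverse)
  then show "vec.span S = UNIV" using vec.span_mono[OF A(2)] by auto
qed

lemma columns_subset_iff: "columns A \<subseteq> S \<longleftrightarrow> (\<forall>j. column j A \<in> S)"
  by (auto simp: columns_def)

section \<open>The spaces \<open>K c\<close> of the overview, supports and Hamming
  intersection\<close>

definition zero_combinations :: "('q::field \<Rightarrow> 'e::field) \<Rightarrow> 'e^'n \<Rightarrow> ('q^'n) set" where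
  "zero_combinations emb c = {a. (\<Sum>j\<in>UNIV. emb (a $ j) * c $ j) = 0}"

definition column_combination :: "('q::field \<Rightarrow> 'e::field) \<Rightarrow> 'e^'n^'d \<Rightarrow> 'q^'n \<Rightarrow> 'e^'d" where
  "column_combination emb G a = (\<Sum>j\<in>UNIV. emb (a $ j) *s column j G)"

text \<open>The \<Gamma>-coordinates of the combination of the entries of \<open>c\<close> with
  coefficients \<open>a\<close> are the products of \<open>a\<close> with the rows of the coordinate
  matrix. By independence of \<Gamma> the combination vanishes iff all of them do.\<close>

lemma zero_combinations_eq_annihilator:
  fixes emb :: "'q::field \<Rightarrow> 'e::field" and \<Gamma> :: "'m::finite \<Rightarrow> 'e"
  assumes emb: "field_embedding emb" and \<Gamma>: "ext_basis emb \<Gamma>"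
  shows "zero_combinations emb c = annihilator (support emb \<Gamma> c)"
proof -
  let ?M = "coord_matrix emb \<Gamma> c"
  have expand: "(\<Sum>i\<in>UNIV. emb (\<Sum>j\<in>UNIV. a $ j * ?M $ i $ j) * \<Gamma> i) = (\<Sum>j\<in>UNIV. emb (a $ j) * c $ j)" for a
  proof -
    have "(\<Sum>i\<in>UNIV. emb (\<Sum>j\<in>UNIV. a $ j * ?M $ i $ j) * \<Gamma> i)
      = (\<Sum>i\<in>UNIV. \<Sum>j\<in>UNIV. emb (a $ j) * (emb (?M $ i $ j) * \<Gamma> i))"
      using emb by (simp add: field_embedding_sum field_embedding_def sum_distrib_right sum_distrib_left mult_ac)
    also have "\<dots> = (\<Sum>j\<in>UNIV. emb (a $ j) * (\<Sum>i\<in>UNIV. emb (?M $ i $ j) * \<Gamma> i))"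
      by (subst sum.swap) (simp add: sum_distrib_left)
    finally show ?thesis by (simp add: coord_matrix_sum[OF emb \<Gamma>])
  qed
  have "a \<in> zero_combinations emb c \<longleftrightarrow> (\<forall>i. dot a (row i ?M) = 0)" for a
  proof
    assume "a \<in> zero_combinations emb c"
    then have "(\<Sum>i\<in>UNIV. emb (\<Sum>j\<in>UNIV. a $ j * ?M $ i $ j) * \<Gamma> i) = 0"
      by (simp add: expand zero_combinations_def)
    then show "\<forall>i. dot a (row i ?M) = 0"
      using coord_matrix_unique[OF emb \<Gamma>, of "\<lambda>i. \<Sum>j\<in>UNIV. a $ j * ?M $ i $ j"]
      by (simp add: dot_def row_def)
  next
    assume "\<forall>i. dot a (row i ?M) = 0"
    then show "a \<in> zero_combinations emb c"
      using expand[of a] field_embedding_0[OF emb] by (simp add: zero_combinations_def dot_def row_def)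
  qed
  then have "zero_combinations emb c = annihilator (rows ?M)"
    by (auto simp: annihilator_def rows_def)
  then show ?thesis by (simp add: support_def annihilator_span)
qed

lemma supports_disjoint_iff:
  fixes \<Gamma> :: "'m::finite \<Rightarrow> 'e::field"
  assumes "field_embedding emb" "ext_basis emb \<Gamma>"
  shows "support emb \<Gamma> c \<inter> support emb \<Gamma> c' = {0} \<longleftrightarrow>
    vec.span (zero_combinations emb c \<union> zero_combinations emb c') = UNIV"
  by (simp add: zero_combinations_eq_annihilator[OF assms] span_annihilators_eq_UNIV_iff
      support_def)

lemma mult_map_matrix_eq_0_iff:
  "(c v* map_matrix emb A) $ j = 0 \<longleftrightarrow> column j A \<in> zero_combinations emb c"
  by (simp add: vector_matrix_mult_def map_matrix_def zero_combinations_def column_def mult.commute)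

text \<open>Entry \<open>j\<close> of \<open>c A\<close> is zero iff column \<open>j\<close> of
  \<open>A\<close> lies in \<open>K c\<close>. Invertibility of \<open>A\<close> makes the nonzero
  words of the new code exactly the images of the nonzero words of \<open>C\<close>.\<close>

lemma not_hamming_intersecting_code_times_iff:
  fixes emb :: "'q::field \<Rightarrow> 'e::field" and A :: "'q^'n^'n"
  assumes emb: "field_embedding emb" and A: "invertible A"
  shows "\<not> hamming_intersecting (code_times emb C A) \<longleftrightarrow>
    (\<exists>c\<in>C - {0}. \<exists>c'\<in>C - {0}. columns A \<subseteq> zero_combinations emb c \<union> zero_combinations emb c')"
proof -
  obtain B where B: "A ** B = mat 1" using A by (auto simp: invertible_def)
  \<comment> \<open>A field embedding respects matrix products, so \<open>B\<close> remains a right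
    inverse over the extension field.\<close>
  have inv: "map_matrix emb A ** map_matrix emb B = mat 1"
  proof -
    have "map_matrix emb A ** map_matrix emb B = map_matrix emb (A ** B)"
      using emb by (simp add: matrix_matrix_mult_def map_matrix_def vec_eq_iff
          field_embedding_sum field_embedding_def)
    also have "\<dots> = mat 1"
      using emb field_embedding_0[OF emb]
      by (simp add: B map_matrix_def mat_def vec_eq_iff field_embedding_def)
    finally show ?thesis .
  qed
  have nz: "c v* map_matrix emb A = 0 \<longleftrightarrow> c = 0" for c
  proof
    assume "c v* map_matrix emb A = 0"
    then have "(c v* map_matrix emb A) v* map_matrix emb B = 0"
      by (simp add: vector_matrix_mult_def vec_eq_iff)
    then show "c = 0" by (simp add: vector_matrix_mul_assoc inv)
  qed (simp add: vector_matrix_mult_def vec_eq_iff)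
  have "code_times emb C A - {0} = (\<lambda>c. c v* map_matrix emb A) ` (C - {0})"
    using nz by (auto simp: code_times_def)
  then have "\<not> hamming_intersecting (code_times emb C A) \<longleftrightarrow>
      (\<exists>c\<in>C - {0}. \<exists>c'\<in>C - {0}. \<forall>j. (c v* map_matrix emb A) $ j = 0 \<or> (c' v* map_matrix emb A) $ j = 0)"
    by (simp add: hamming_intersecting_def)
  then show ?thesis by (simp add: mult_map_matrix_eq_0_iff columns_subset_iff)
qed

section \<open>Codewords, hyperplanes and projective points\<close>

lemma span_rows_eq: "vec.span (rows G) = range (\<lambda>u. u v* (G :: 'e::field^'n^'d))"
proof -
  have eq: "u v* G = (\<Sum>i\<in>UNIV. u $ i *s row i G)" for u
    by (simp add: vector_matrix_mult_def row_def vec_eq_iff mult.commute)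
  show ?thesis
  proof
    have "vec.subspace (range (\<lambda>u. u v* G))"
      unfolding vec.subspace_def
    proof (intro conjI ballI allI)
      show "0 \<in> range (\<lambda>u. u v* G)" by (rule range_eqI[of _ _ 0]) simp
    next
      fix x y assume "x \<in> range (\<lambda>u. u v* G)" "y \<in> range (\<lambda>u. u v* G)"
      then obtain u w where "x = u v* G" "y = w v* G" by blast
      then have "x + y = (u + w) v* G" by (simp add: eq sum.distrib vec.scale_left_distrib)
      then show "x + y \<in> range (\<lambda>u. u v* G)" by simp
    next
      fix a x assume "x \<in> range (\<lambda>u. u v* G)"
      then obtain u where "x = u v* G" by blast
      then have "a *s x = (a *s u) v* G" by (simp add: eq vec.scale_sum_right)
      then show "a *s x \<in> range (\<lambda>u. u v* G)" by simp
    qed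
    moreover have "row i G = axis i 1 v* G" for i
      by (simp add: eq axis_def vec_eq_iff if_distrib[of "\<lambda>x. x * _"] cong: if_cong)
    ultimately show "vec.span (rows G) \<subseteq> range (\<lambda>u. u v* G)"
      by (intro vec.span_minimal) (auto simp: rows_def)
    show "range (\<lambda>u. u v* G) \<subseteq> vec.span (rows G)"
      unfolding eq
      by (intro image_subsetI vec.span_sum vec.span_scale vec.span_base) (auto simp: rows_def)
  qed
qed

lemma dot_column: "dot u (column j G) = (u v* G) $ j"
  by (simp add: dot_def column_def vector_matrix_mult_def mult.commute)

text \<open>If \<open>u v* G = 0\<close>, then \<open>u\<close> annihilates the columns of
  \<open>G\<close>, which span, so \<open>u = 0\<close>. Thus nonzero codewords can be replaced by
  normal vectors of hyperplanes.\<close>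

lemma generator_matrix_nonzero_codewords:
  fixes G :: "'e::{field,finite}^'n^'d"
  assumes G: "generator_matrix G C"
  shows "C - {0} = (\<lambda>u. u v* G) ` (- {0})"
proof -
  have "u = 0" if "u v* G = 0" for u
  proof -
    have "u \<in> annihilator (columns G)"
      using that by (auto simp: annihilator_def columns_def dot_column)
    then have "u \<in> annihilator (vec.span (columns G))" by (simp add: annihilator_span)
    then show ?thesis by (simp add: generator_matrix_span_columns[OF G] annihilator_UNIV)
  qed
  moreover have "C = range (\<lambda>u. u v* G)"
    using G by (simp add: generator_matrix_def span_rows_eq)
  ultimately show ?thesis by auto
qed

text \<open>This is the dictionary between hyperplanes and codewords: pairing \<open>u\<close> with
  \<open>G a\<close> combines the entries of \<open>u v* G\<close> with coefficients
  \<open>a\<close>.\<close>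

lemma column_combination_in_hyperplane_iff:
  "dot u (column_combination emb G a) = 0 \<longleftrightarrow> a \<in> zero_combinations emb (u v* G)"
  by (simp add: column_combination_def dot_sum_right dot_scale_right dot_column zero_combinations_def)

lemma column_mult_map_matrix:
  "column j (G ** map_matrix emb A) = column_combination emb G (column j A)"
  by (simp add: column_combination_def column_def map_matrix_def matrix_matrix_mult_def vec_eq_iff mult.commute)

text \<open>A point lies in a hyperplane iff a vector spanning it is orthogonal to the normal
  vector. A zero column would give the zero space, which is no point and belongs to no projective
  hyperplane; \<open>nz\<close> excludes this.\<close>

lemma in_two_hyperplanes_iff:
  fixes M :: "'e::field^'n^'d"
  assumes nz: "\<And>j. column j M \<noteq> 0"
  shows "in_two_hyperplanes (column_points M) \<longleftrightarrow>
    (\<exists>u\<in>- {0}. \<exists>u'\<in>- {0}. \<forall>j. dot u (column j M) = 0 \<or> dot u' (column j M) = 0)"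
proof -
  have mem: "vec.span {v} \<in> {P \<in> pg_points. P \<subseteq> {v. dot u v = 0}} \<longleftrightarrow> dot u v = 0"
    if "v \<noteq> 0" for u v :: "'e^'d"
  proof -
    have "vec.span {v} \<in> pg_points" using that by (auto simp: pg_points_def)
    moreover have "vec.span {v} \<subseteq> {v. dot u v = 0} \<longleftrightarrow> dot u v = 0"
      using vec.span_minimal[OF _ subspace_dot[of u], of "{v}"] vec.span_base[of v "{v}"] by auto
    ultimately show ?thesis by simp
  qed
  have pg: "pg_hyperplanes = (\<lambda>u :: 'e^'d. {P \<in> pg_points. P \<subseteq> {v. dot u v = 0}}) ` (- {0})"
    by (auto simp: pg_hyperplanes_def hyperplane_iff)
  have set: "set_mset (column_points M) = range (\<lambda>j. vec.span {column j M})"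
    by (simp add: column_points_def)
  show ?thesis
    unfolding in_two_hyperplanes_def pg set bex_simps(7) image_subset_iff Un_iff
      mem[OF nz] by simp
qed

lemma in_two_hyperplanes_code_iff:
  fixes emb :: "'q::{field,finite} \<Rightarrow> 'e::{field,finite}" and G :: "'e^'n^'d"
    and \<Gamma> :: "'m::finite \<Rightarrow> 'e" and A :: "'q^'n^'n"
  assumes emb: "field_embedding emb" and \<Gamma>: "ext_basis emb \<Gamma>"
    and nd: "nondegenerate emb \<Gamma> C" and G: "generator_matrix G C" and A: "invertible A"
  shows "in_two_hyperplanes (column_points (G ** map_matrix emb A)) \<longleftrightarrow>
    (\<exists>c\<in>C - {0}. \<exists>c'\<in>C - {0}. columns A \<subseteq> zero_combinations emb c \<union> zero_combinations emb c')"
proof -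
  \<comment> \<open>Nondegeneracy makes the columns of \<open>G\<close> independent over the base
    field, so a zero column here would force a zero column of the invertible matrix
    \<open>A\<close>.\<close>
  have "column j (G ** map_matrix emb A) \<noteq> 0" for j
  proof
    assume "column j (G ** map_matrix emb A) = 0"
    then have "column j A = 0"
      using nondegenerate_columns[OF emb \<Gamma> nd G, of "column j A"]
      by (simp add: column_mult_map_matrix column_combination_def)
    moreover obtain B where "B ** A = mat 1" using A by (auto simp: invertible_def)
    then have "(B ** A) $ j $ j = 1" by (simp add: mat_def)
    ultimately show False by (simp add: matrix_matrix_mult_def column_def vec_eq_iff)
  qed
  then show ?thesis
    unfolding generator_matrix_nonzero_codewords[OF G]
    by (simp add: in_two_hyperplanes_iff column_mult_map_matrix column_combination_in_hyperplane_iff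
        columns_subset_iff)
qed

section \<open>The system of the code and 2-spannability\<close>

lemma column_combination_add:
  assumes "field_embedding emb"
  shows "column_combination emb G (a + b) = column_combination emb G a + column_combination emb G b"
  using assms by (simp add: column_combination_def field_embedding_def vec.scale_left_distrib sum.distrib)

lemma code_system_eq:
  fixes emb :: "'q::field \<Rightarrow> 'e::field" and G :: "'e^'n^'d"
  assumes emb: "field_embedding emb"
  shows "code_system emb G = range (column_combination emb G)"
proof -
  interpret q: vector_space "scale_vec emb :: 'q \<Rightarrow> 'e^'d \<Rightarrow> 'e^'d"
    using field_embedding_vector_space(2)[OF emb] .
  show ?thesis
    unfolding code_system_def
  proof
    have "q.subspace (range (column_combination emb G))"
      unfolding q.subspace_def
    proof (intro conjI ballI allI)
      show "0 \<in> range (column_combination emb G)"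
        by (rule range_eqI[of _ _ 0]) (simp add: column_combination_def field_embedding_0[OF emb])
    next
      fix x y assume "x \<in> range (column_combination emb G)" "y \<in> range (column_combination emb G)"
      then show "x + y \<in> range (column_combination emb G)"
        by (auto simp flip: column_combination_add[OF emb])
    next
      fix a x assume "x \<in> range (column_combination emb G)"
      then obtain b where "x = column_combination emb G b" by blast
      then have "emb a *s x = column_combination emb G (a *s b)"
        using emb by (simp add: column_combination_def field_embedding_def vec.scale_sum_right)
      then show "emb a *s x \<in> range (column_combination emb G)" by simp
    qed
    moreover have "column j G = column_combination emb G (axis j 1)" for j
    proof -
      have "emb (axis j 1 $ i) = (if i = j then 1 else 0)" for i
        using emb field_embedding_0[OF emb] by (simp add: axis_def field_embedding_def)
      then show ?thesis
        by (simp add: column_combination_def vec_eq_iff if_distrib[of "\<lambda>x. x * _"] cong: if_cong)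
    qed
    ultimately show "q.span (columns G) \<subseteq> range (column_combination emb G)"
      by (intro q.span_minimal) (auto simp: columns_def)
    show "range (column_combination emb G) \<subseteq> q.span (columns G)"
      unfolding column_combination_def
      by (intro image_subsetI q.span_sum q.span_scale q.span_base) (auto simp: columns_def)
  qed
qed

lemma subspace_zero_combinations:
  assumes emb: "field_embedding emb"
  shows "vec.subspace (zero_combinations emb c)"
  using emb field_embedding_0[OF emb]
  by (auto simp: vec.subspace_def zero_combinations_def field_embedding_def algebra_simps
      sum.distrib simp flip: sum_distrib_left)

text \<open>The additive map \<open>?\<phi>\<close> carries \<open>K (u v* G)\<close> onto the part
  of the system in the hyperplane normal to \<open>u\<close>, and sums to sums. Since it is
  injective, the decomposition of the system can be pulled back to the coefficient space.\<close>

lemma two_spannable_code_system_iff: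
  fixes emb :: "'q::{field,finite} \<Rightarrow> 'e::{field,finite}" and G :: "'e^'n^'d"
    and \<Gamma> :: "'m::finite \<Rightarrow> 'e"
  assumes emb: "field_embedding emb" and \<Gamma>: "ext_basis emb \<Gamma>"
    and nd: "nondegenerate emb \<Gamma> C" and G: "generator_matrix G C"
  shows "two_spannable (code_system emb G) \<longleftrightarrow>
    (\<exists>c\<in>C - {0}. \<exists>c'\<in>C - {0}. vec.span (zero_combinations emb c \<union> zero_combinations emb c') = UNIV)"
proof -
  let ?\<phi> = "column_combination emb G"
  \<comment> \<open>Nondegeneracy enters here: the columns of \<open>G\<close> are independent over
    the base field.\<close>
  have inj: "inj ?\<phi>"
  proof (rule injI)
    fix a b assume "?\<phi> a = ?\<phi> b"
    moreover have "?\<phi> a = ?\<phi> (a - b) + ?\<phi> b"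
      by (simp flip: column_combination_add[OF emb])
    ultimately have "?\<phi> (a - b) = 0" by simp
    then have "a - b = 0"
      using nondegenerate_columns[OF emb \<Gamma> nd G, of "a - b"] by (simp add: column_combination_def)
    then show "a = b" by simp
  qed
  have inter: "{v. dot u v = 0} \<inter> range ?\<phi> = ?\<phi> ` zero_combinations emb (u v* G)" for u
    by (auto simp: column_combination_in_hyperplane_iff)
  have "{x + y | x y. x \<in> {v. dot u v = 0} \<inter> range ?\<phi> \<and> y \<in> {v. dot u' v = 0} \<inter> range ?\<phi>}
      = ?\<phi> ` vec.span (zero_combinations emb (u v* G) \<union> zero_combinations emb (u' v* G))" for u u'
  proof -
    have "{x + y | x y. x \<in> ?\<phi> ` S \<and> y \<in> ?\<phi> ` T} = ?\<phi> ` {x + y | x y. x \<in> S \<and> y \<in> T}" for S T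
      by (force simp: column_combination_add[OF emb] intro!: image_eqI)
    then show ?thesis
      unfolding inter by (simp add: span_Un_subspaces subspace_zero_combinations[OF emb])
  qed
  moreover have "two_spannable U \<longleftrightarrow> (\<exists>u\<in>- {0}. \<exists>u'\<in>- {0}.
      U = {x + y | x y. x \<in> {v. dot u v = 0} \<inter> U \<and> y \<in> {v. dot u' v = 0} \<inter> U})" for U :: "('e^'d) set"
  proof -
    have "Collect hyperplane = (\<lambda>u :: 'e^'d. {v. dot u v = 0}) ` (- {0})"
      by (auto simp: hyperplane_iff)
    moreover have "two_spannable U \<longleftrightarrow> (\<exists>H1\<in>Collect hyperplane. \<exists>H2\<in>Collect hyperplane.
        U = {x + y | x y. x \<in> H1 \<inter> U \<and> y \<in> H2 \<inter> U})"
      by (simp add: two_spannable_def)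
    ultimately show ?thesis by (simp only: bex_simps(7))
  qed
  ultimately have "two_spannable (range ?\<phi>) \<longleftrightarrow>
      (\<exists>u\<in>- {0}. \<exists>u'\<in>- {0}. range ?\<phi>
        = ?\<phi> ` vec.span (zero_combinations emb (u v* G) \<union> zero_combinations emb (u' v* G)))"
    by simp
  then show ?thesis
    unfolding generator_matrix_nonzero_codewords[OF G] code_system_eq[OF emb]
    \<comment> \<open>\<open>range ?\<phi>\<close> is the image of \<open>UNIV\<close>, so
      injectivity cancels \<open>?\<phi>\<close> and leaves an equation between \<open>UNIV\<close>
      and the span.\<close>
    by (simp only: bex_simps(7) inj_image_eq_iff[OF inj] eq_commute[of UNIV])
qed

theorem theorem3p4:
  fixes emb :: "'q::{field,finite} \<Rightarrow> 'e::{field,finite}"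
    and \<Gamma> :: "'m::finite \<Rightarrow> 'e"
    and C :: "('e^'n) set"
    and G :: "'e^'n^'d"
    and d :: nat
  assumes "field_embedding emb"
    and "ext_basis emb \<Gamma>"
    and "rank_code emb \<Gamma> CARD('d) d C"
    and "nondegenerate emb \<Gamma> C"
    and "generator_matrix G C"
  shows "(rank_intersecting emb \<Gamma> C \<longleftrightarrow>
            (\<forall>A :: 'q^'n^'n. invertible A \<longrightarrow> hamming_intersecting (code_times emb C A)))
       \<and> ((\<forall>A :: 'q^'n^'n. invertible A \<longrightarrow> hamming_intersecting (code_times emb C A)) \<longleftrightarrow>
            (\<forall>A :: 'q^'n^'n. invertible A \<longrightarrow>
               \<not> in_two_hyperplanes (column_points (G ** map_matrix emb A))))
       \<and> ((\<forall>A :: 'q^'n^'n. invertible A \<longrightarrow>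
               \<not> in_two_hyperplanes (column_points (G ** map_matrix emb A))) \<longleftrightarrow>
            \<not> two_spannable (code_system emb G))"
proof -
  let ?K = "zero_combinations emb :: 'e^'n \<Rightarrow> ('q^'n) set"
  \<comment> \<open>Statements (1) and (4) each negate \<open>?split\<close>, while (2) and (3) say
    that no invertible \<open>A\<close> satisfies \<open>covers\<close>; \<open>split\<close> joins
    the two pairs.\<close>
  let ?split = "\<exists>c\<in>C - {0}. \<exists>c'\<in>C - {0}. vec.span (?K c \<union> ?K c') = UNIV"
  define covers :: "'q^'n^'n \<Rightarrow> bool" where
    "covers A \<longleftrightarrow> (\<exists>c\<in>C - {0}. \<exists>c'\<in>C - {0}. columns A \<subseteq> ?K c \<union> ?K c')" for A
  have split: "?split \<longleftrightarrow> (\<exists>A. invertible A \<and> covers A)"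
    unfolding span_eq_UNIV_iff_invertible covers_def by blast
  have "rank_intersecting emb \<Gamma> C \<longleftrightarrow> \<not> ?split"
    by (simp add: rank_intersecting_def supports_disjoint_iff[OF assms(1,2)])
  moreover have "hamming_intersecting (code_times emb C A) \<longleftrightarrow> \<not> covers A" if "invertible A" for A
    unfolding covers_def not_hamming_intersecting_code_times_iff[OF assms(1) that, symmetric] by simp
  moreover have "in_two_hyperplanes (column_points (G ** map_matrix emb A)) \<longleftrightarrow> covers A"
    if "invertible A" for A
    unfolding covers_def by (rule in_two_hyperplanes_code_iff[OF assms(1,2,4,5) that])
  moreover have "two_spannable (code_system emb G) \<longleftrightarrow> ?split"
    by (rule two_spannable_code_system_iff[OF assms(1,2,4,5)])
  ultimately show ?thesis unfolding split by simp
qed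

end
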